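(* Let $X$ be a complex normed space, $B$ a finite-dimensional complex normed vector space, $T:X\to B$ a continuous surjective linear map, and $q_T(b)=\inf\{\|x\|_X:Tx=b\}$. Let $U\subseteq B$ be nonempty, compact and convex. Then for every $b\in B$, $$\inf_{u\in U}q_T(b+u)=\sup_{\substack{\varphi\in B^*\\ \|T^*\varphi\|_{X^*}\le1}}\bigl(\operatorname{Re}\varphi(b)-\sigma_U(-\varphi)\bigr).$$
   Context: $X^*,B^*$ are the continuous duals and $T^*\varphi=\varphi\circ T$. The support function of $U$, on the underlying real vector space, is $\sigma_U(\varphi)=\sup_{u\in U}\operatorname{Re}\varphi(u)$ for $\varphi\in B^*$. *)

theory Defs
  imports "HOL-Analysis.Analysis"
begin

text \<open>
  A complex normed space is given as a real normed space together with a complex scalar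
  multiplication that extends the real one. The topology, \<^const>\<open>norm\<close> and \<^const>\<open>convex\<close>
  are thus those of the underlying real normed space.
\<close>

class complex_normed_vector = real_normed_vector +
  fixes scaleC :: "complex \<Rightarrow> 'a \<Rightarrow> 'a"  (infixr "*\<^sub>C" 75)
  assumes scaleC_add_right: "a *\<^sub>C (x + y) = a *\<^sub>C x + a *\<^sub>C y"
    and scaleC_add_left: "(a + b) *\<^sub>C x = a *\<^sub>C x + b *\<^sub>C x"
    and scaleC_scaleC: "a *\<^sub>C (b *\<^sub>C x) = (a * b) *\<^sub>C x"
    and scaleC_of_real: "complex_of_real r *\<^sub>C x = r *\<^sub>R x"
    and norm_scaleC: "norm (a *\<^sub>C x) = cmod a * norm x"

lemma vector_space_scaleC:
  "vector_space (scaleC :: complex \<Rightarrow> 'a \<Rightarrow> 'a::complex_normed_vector)"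
proof
  fix x :: 'a
  show "1 *\<^sub>C x = x"
    using scaleC_of_real[of 1 x] by simp
qed (simp_all add: scaleC_add_right scaleC_add_left scaleC_scaleC)

instantiation complex :: complex_normed_vector
begin

definition scaleC_complex :: "complex \<Rightarrow> complex \<Rightarrow> complex" where
  "scaleC_complex a z = a * z"

instance
  by standard (simp_all add: scaleC_complex_def algebra_simps norm_mult scaleR_conv_of_real)

end

abbreviation clinear :: "('a::complex_normed_vector \<Rightarrow> 'b::complex_normed_vector) \<Rightarrow> bool" where
  "clinear \<equiv> Vector_Spaces.linear scaleC scaleC"

definition continuous_dual :: "('a::complex_normed_vector \<Rightarrow> complex) set" where
  "continuous_dual = {\<phi>. clinear \<phi> \<and> continuous_on UNIV \<phi>}"

text \<open>
  The following infimum and supremum are taken in the reals. The infimum is meaningful for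
  \<open>b\<close> in the range of \<open>T\<close>, the supremum for nonempty \<open>U\<close> on which \<open>Re \<circ> \<phi>\<close> is bounded above.
\<close>

definition quotient_norm ::
    "('a::complex_normed_vector \<Rightarrow> 'b::complex_normed_vector) \<Rightarrow> 'b \<Rightarrow> real" where
  "quotient_norm T b = Inf {norm x | x. T x = b}"

definition support_function ::
    "'b::complex_normed_vector set \<Rightarrow> ('b \<Rightarrow> complex) \<Rightarrow> real" where
  "support_function U \<phi> = (SUP u\<in>U. Re (\<phi> u))"

end

theory Submission
  imports Defs
begin

text \<open>
  One inequality is pointwise: if \<open>\<parallel>\<phi> \<circ> T\<parallel> \<le> 1\<close> and \<open>T x = b + u\<close>, then
  \<open>Re (\<phi> b) - \<sigma>\<^sub>U (-\<phi>) \<le> Re (\<phi> (b + u)) = Re (\<phi> (T x)) \<le> \<parallel>x\<parallel>\<close>.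

  For the other one the supremum is attained. Let \<open>m\<close> be the infimum of the seminorm \<open>q = q\<^sub>T\<close> over
  the convex set \<open>C = b + U\<close>. By the theorem of Mazur and Orlicz (\<open>mazur_orlicz\<close>) there is a real
  linear functional \<open>f \<le> q\<close> with \<open>f \<ge> m\<close> on all of \<open>C\<close>. It is the real part of the complex linear
  functional \<open>\<phi> y = f y - \<i> f (\<i> y)\<close>. Rotating \<open>\<phi> (T x)\<close> to the positive real axis turns
  \<open>f \<circ> T \<le> q \<circ> T \<le> \<parallel>\<cdot>\<parallel>\<close> into \<open>\<parallel>\<phi> \<circ> T\<parallel> \<le> 1\<close>, and \<open>f \<ge> m\<close> on \<open>b + U\<close> says
  \<open>Re (\<phi> b) - \<sigma>\<^sub>U (-\<phi>) \<ge> m\<close>. That \<open>\<phi>\<close> is continuous is the fact that linear functionals on a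
  finite-dimensional normed space are bounded (\<open>bounded_linear_functional_finite_span\<close>).

  The functional of Mazur and Orlicz is found by lowering \<open>q\<close> repeatedly. For a convex set \<open>C\<close> on
  which a sublinear \<open>p\<close> is at least \<open>m\<close>, there is a largest sublinear functional below \<open>p\<close>
  whose value at \<open>-c\<close> is at most \<open>-m\<close> for all \<open>c \<in> C\<close> (\<open>tighten\<close> below). Lowering \<open>q\<close> along
  \<open>b + U\<close> secures the bound on \<open>C\<close>; lowering the result along each singleton \<open>{s}\<close>, with \<open>s\<close> from a
  finite spanning set and the current value at \<open>s\<close> as the constant, makes it odd at \<open>s\<close>, and a
  sublinear functional that is odd on a spanning set is linear.
\<close>

section \<open>Sublinear functionals and the Mazur--Orlicz theorem\<close>

definition sublinear :: "('a::real_vector \<Rightarrow> real) \<Rightarrow> bool" where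
  "sublinear p \<longleftrightarrow> (\<forall>x y. p (x + y) \<le> p x + p y) \<and> (\<forall>t x. 0 \<le> t \<longrightarrow> p (t *\<^sub>R x) = t * p x)"

lemma sublinear_add: "sublinear p \<Longrightarrow> p (x + y) \<le> p x + p y"
  and sublinear_scale: "sublinear p \<Longrightarrow> 0 \<le> t \<Longrightarrow> p (t *\<^sub>R x) = t * p x"
  by (simp_all add: sublinear_def)

lemma sublinear_zero: "sublinear p \<Longrightarrow> p 0 = 0"
  using sublinear_scale[of p 0 0] by simp

lemma sublinear_minus: "sublinear p \<Longrightarrow> - p (- x) \<le> p x"
  using sublinear_add[of p x "- x"] sublinear_zero[of p] by simp

text \<open>For positive factors, one inequality gives the other by scaling back.\<close>

lemma sublinearI:
  assumes add: "\<And>x y. p (x + y) \<le> p x + p y"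
    and scale: "\<And>t x. 0 < t \<Longrightarrow> p (t *\<^sub>R x) \<le> t * p x"
    and zero: "p 0 = 0"
  shows "sublinear p"
  unfolding sublinear_def
proof (intro conjI allI impI)
  fix t :: real and x
  assume "0 \<le> t"
  show "p (t *\<^sub>R x) = t * p x"
  proof (cases "t = 0")
    case False
    with \<open>0 \<le> t\<close> have t: "0 < t" by simp
    have "p ((1 / t) *\<^sub>R t *\<^sub>R x) \<le> (1 / t) * p (t *\<^sub>R x)"
      by (rule scale) (use t in simp)
    then have "t * p x \<le> p (t *\<^sub>R x)"
      using t by (simp add: field_simps)
    with scale[OF t, of x] show ?thesis by simp
  qed (simp add: zero)
qed (rule add)

text \<open>
  If \<open>g \<le> p\<close> is sublinear with \<open>g (- c) \<le> - m\<close> for \<open>c \<in> C\<close>, then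
  \<open>g y \<le> g (y + t c) + t g (- c) \<le> p (y + t c) - t m\<close> for all \<open>t \<ge> 0\<close>. The best of these upper
  bounds is itself such a functional.
\<close>

definition tighten :: "('a::real_vector \<Rightarrow> real) \<Rightarrow> 'a set \<Rightarrow> real \<Rightarrow> 'a \<Rightarrow> real" where
  "tighten p C m y = (INF (t, c)\<in>{0..} \<times> C. p (y + t *\<^sub>R c) - t * m)"

context
  fixes p :: "'a::real_vector \<Rightarrow> real" and C :: "'a set" and m :: real
  assumes p: "sublinear p" and convex: "convex C" and nonempty: "C \<noteq> {}"
    and bound: "\<And>c. c \<in> C \<Longrightarrow> m \<le> p c"
begin

text \<open>The bound on \<open>C\<close> is what keeps the infimum finite.\<close>

lemma tighten_lower_bound:
  assumes "0 \<le> t" "c \<in> C"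
  shows "- p (- y) \<le> p (y + t *\<^sub>R c) - t * m"
proof -
  have "t * m \<le> t * p c"
    using assms bound by (simp add: mult_left_mono)
  also have "\<dots> = p ((y + t *\<^sub>R c) + (- y))"
    using assms by (simp add: sublinear_scale[OF p])
  also have "\<dots> \<le> p (y + t *\<^sub>R c) + p (- y)"
    by (rule sublinear_add[OF p])
  finally show ?thesis by simp
qed

lemma tighten_le:
  assumes "0 \<le> t" "c \<in> C"
  shows "tighten p C m y \<le> p (y + t *\<^sub>R c) - t * m"
proof -
  have "bdd_below ((\<lambda>(t, c). p (y + t *\<^sub>R c) - t * m) ` ({0..} \<times> C))"
    by (rule bdd_belowI[of _ "- p (- y)"]) (auto intro: tighten_lower_bound)
  from cINF_lower[OF this, of "(t, c)"] show ?thesis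
    unfolding tighten_def using assms by simp
qed

lemma tighten_greatest:
  assumes "\<And>t c. 0 \<le> t \<Longrightarrow> c \<in> C \<Longrightarrow> r \<le> p (y + t *\<^sub>R c) - t * m"
  shows "r \<le> tighten p C m y"
  unfolding tighten_def by (rule cINF_greatest) (use nonempty assms in auto)

lemma tighten_le_self: "tighten p C m y \<le> p y"
  using nonempty tighten_le[of 0 _ y] by auto

lemma tighten_minus: "c \<in> C \<Longrightarrow> tighten p C m (- c) \<le> - m"
  using tighten_le[of 1 c "- c"] by (simp add: sublinear_zero[OF p])

text \<open>Subadditivity is where convexity enters: \<open>s c + t d\<close> is \<open>s + t\<close> times a point of \<open>C\<close>.\<close>

lemma sublinear_tighten: "sublinear (tighten p C m)"
proof (rule sublinearI)
  fix x y
  have split: "tighten p C m (x + y) \<le> (p (x + s *\<^sub>R c) - s * m) + (p (y + t *\<^sub>R d) - t * m)"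
    if s: "0 \<le> s" and c: "c \<in> C" and t: "0 \<le> t" and d: "d \<in> C" for s t c d
  proof -
    obtain e where e: "e \<in> C" "(s + t) *\<^sub>R e = s *\<^sub>R c + t *\<^sub>R d"
    proof (cases "s + t = 0")
      case True
      with s t have "s = 0" "t = 0" by auto
      then show ?thesis using that[of c] c by simp
    next
      case False
      with s t have pos: "0 < s + t" by simp
      have "(s / (s + t)) *\<^sub>R c + (t / (s + t)) *\<^sub>R d \<in> C"
        using pos s t c d
        by (intro convexD[OF convex]) (simp_all flip: add_divide_distrib)
      moreover have "(s + t) *\<^sub>R ((s / (s + t)) *\<^sub>R c + (t / (s + t)) *\<^sub>R d) = s *\<^sub>R c + t *\<^sub>R d"
        using pos by (simp add: scaleR_right_distrib)
      ultimately show ?thesis by (rule that)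
    qed
    have "tighten p C m (x + y) \<le> p (x + y + (s + t) *\<^sub>R e) - (s + t) * m"
      using s t e(1) by (intro tighten_le) auto
    also have "x + y + (s + t) *\<^sub>R e = (x + s *\<^sub>R c) + (y + t *\<^sub>R d)"
      by (simp add: e(2))
    also have "p \<dots> \<le> p (x + s *\<^sub>R c) + p (y + t *\<^sub>R d)"
      by (rule sublinear_add[OF p])
    finally show ?thesis by (simp add: algebra_simps)
  qed
  have "tighten p C m (x + y) - tighten p C m y \<le> tighten p C m x"
  proof (rule tighten_greatest)
    fix s :: real and c
    assume s: "0 \<le> s" and c: "c \<in> C"
    have "tighten p C m (x + y) - (p (x + s *\<^sub>R c) - s * m) \<le> tighten p C m y"
      by (rule tighten_greatest) (use split[OF s c] in \<open>simp add: algebra_simps\<close>)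
    then show "tighten p C m (x + y) - tighten p C m y \<le> p (x + s *\<^sub>R c) - s * m" by simp
  qed
  then show "tighten p C m (x + y) \<le> tighten p C m x + tighten p C m y" by simp
next
  fix r :: real and y
  assume r: "0 < r"
  have "tighten p C m (r *\<^sub>R y) / r \<le> tighten p C m y"
  proof (rule tighten_greatest)
    fix t :: real and c
    assume t: "0 \<le> t" and c: "c \<in> C"
    have "tighten p C m (r *\<^sub>R y) \<le> p (r *\<^sub>R y + (r * t) *\<^sub>R c) - (r * t) * m"
      by (rule tighten_le) (use r t c in auto)
    also have "r *\<^sub>R y + (r * t) *\<^sub>R c = r *\<^sub>R (y + t *\<^sub>R c)"
      by (simp add: scaleR_right_distrib)
    also have "p \<dots> = r * p (y + t *\<^sub>R c)"
      using r by (intro sublinear_scale[OF p]) simp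
    finally show "tighten p C m (r *\<^sub>R y) / r \<le> p (y + t *\<^sub>R c) - t * m"
      using r by (simp add: field_simps)
  qed
  then show "tighten p C m (r *\<^sub>R y) \<le> r * tighten p C m y"
    using r by (simp add: field_simps)
next
  have "- p (- 0) \<le> tighten p C m 0"
    by (rule tighten_greatest) (rule tighten_lower_bound)
  with tighten_le_self[of 0] show "tighten p C m 0 = 0"
    by (simp add: sublinear_zero[OF p])
qed

end

text \<open>
  Oddness at a point survives every further lowering, because \<open>f s\<close> and \<open>f (- s)\<close> can only
  decrease while their sum stays nonnegative. Hence the points can be treated one after the other.
\<close>

lemma exists_sublinear_odd_on_finite:
  assumes "finite S" and "sublinear p"
  shows "\<exists>f. sublinear f \<and> (\<forall>y. f y \<le> p y) \<and> (\<forall>s\<in>S. f (- s) = - f s)"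
  using assms
proof (induction S rule: finite_induct)
  case (insert a S)
  then obtain g where g: "sublinear g" "\<And>y. g y \<le> p y" "\<And>s. s \<in> S \<Longrightarrow> g (- s) = - g s"
    by blast
  define f where "f = tighten g {a} (g a)"
  have f: "sublinear f" "\<And>y. f y \<le> g y" "f (- a) \<le> - g a"
    unfolding f_def by (rule sublinear_tighten tighten_le_self tighten_minus; simp add: g(1))+
  have "f (- s) = - f s" if "s \<in> insert a S" for s
  proof (rule antisym)
    show "f (- s) \<le> - f s"
      using that f(2)[of s] f(2)[of "- s"] f(3) g(3)[of s] by auto
    show "- f s \<le> f (- s)"
      using sublinear_minus[OF f(1), of s] by simp
  qed
  with f g(2) show ?case
    by (meson order_trans)
qed auto

lemma linear_if_sublinear_odd:
  assumes f: "sublinear f" and odd: "\<And>x. f (- x) = - f x"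
  shows "linear f"
proof (rule linearI)
  fix x y
  have "f x \<le> f (x + y) + f (- y)"
    using sublinear_add[OF f, of "x + y" "- y"] by simp
  with sublinear_add[OF f, of x y] show "f (x + y) = f x + f y"
    by (simp add: odd)
next
  fix r :: real and x
  have "f (r *\<^sub>R x) = - f ((- r) *\<^sub>R x)"
    by (simp add: odd)
  then show "f (r *\<^sub>R x) = r *\<^sub>R f x"
    using sublinear_scale[OF f, of r x] sublinear_scale[OF f, of "- r" x]
    by (cases "0 \<le> r") simp_all
qed

text \<open>
  The odd points \<open>x\<close> are those where \<open>f x + f (- x)\<close>, which is never negative, vanishes; by
  sublinearity this defect at \<open>x + y\<close> is at most the sum of the defects at \<open>x\<close> and \<open>y\<close>. So
  oddness spreads from a spanning set to the whole space.
\<close>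

lemma subspace_odd_points:
  assumes f: "sublinear f"
  shows "subspace {x. f (- x) = - f x}"
  unfolding subspace_def
proof (intro conjI ballI allI)
  show "0 \<in> {x. f (- x) = - f x}"
    by (simp add: sublinear_zero[OF f])
next
  fix x y
  assume "x \<in> {x. f (- x) = - f x}" "y \<in> {x. f (- x) = - f x}"
  then have x: "f (- x) = - f x" and y: "f (- y) = - f y" by auto
  show "x + y \<in> {x. f (- x) = - f x}"
    using sublinear_add[OF f, of "- x" "- y"] sublinear_add[OF f, of x y]
      sublinear_minus[OF f, of "x + y"] x y by simp
next
  fix r :: real and x
  assume "x \<in> {x. f (- x) = - f x}"
  then have x: "f (- x) = - f x" by simp
  have "f (- (r *\<^sub>R x)) = - f (r *\<^sub>R x)"
  proof (cases "0 \<le> r")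
    case True
    then show ?thesis
      using sublinear_scale[OF f, of r x] sublinear_scale[OF f, of r "- x"] x by simp
  next
    case False
    then show ?thesis
      using sublinear_scale[OF f, of "- r" x] sublinear_scale[OF f, of "- r" "- x"] x by simp
  qed
  then show "r *\<^sub>R x \<in> {x. f (- x) = - f x}" by simp
qed

text \<open>
  A linear \<open>f\<close> below \<open>tighten p C m\<close> suffices, as \<open>f c = - f (- c) \<ge> m\<close> then holds on \<open>C\<close>. With a
  finite spanning set it is reached in finitely many steps.
\<close>

lemma mazur_orlicz:
  fixes p :: "'a::real_vector \<Rightarrow> real" and S C :: "'a set"
  assumes S: "finite S" "span S = UNIV"
    and p: "sublinear p" and C: "convex C" "C \<noteq> {}" and bound: "\<And>c. c \<in> C \<Longrightarrow> m \<le> p c"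
  obtains f where "linear f" "\<And>y. f y \<le> p y" "\<And>c. c \<in> C \<Longrightarrow> m \<le> f c"
proof -
  note tightened = p C bound
  obtain f where f: "sublinear f" "\<And>y. f y \<le> tighten p C m y"
      "\<And>s. s \<in> S \<Longrightarrow> f (- s) = - f s"
    using exists_sublinear_odd_on_finite[OF S(1) sublinear_tighten[OF tightened]] by blast
  have "span S \<subseteq> {x. f (- x) = - f x}"
    by (rule span_minimal) (use f in \<open>auto intro: subspace_odd_points\<close>)
  with S(2) have odd: "f (- x) = - f x" for x by auto
  show ?thesis
  proof
    show "linear f"
      using f(1) odd by (rule linear_if_sublinear_odd)
    show "f y \<le> p y" for y
      using f(2) tighten_le_self[OF tightened] by (rule order_trans)
    show "m \<le> f c" if "c \<in> C" for c
      using order_trans[OF f(2) tighten_minus[OF tightened that]] odd[of c] by simp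
  qed
qed

section \<open>Boundedness of linear functionals in finite dimension\<close>

lemma Cauchy_diff:
  fixes x y :: "nat \<Rightarrow> 'a::real_normed_vector"
  assumes "Cauchy x" and "Cauchy y"
  shows "Cauchy (\<lambda>n. x n - y n)"
proof (rule CauchyI)
  fix e :: real
  assume "0 < e"
  then have "0 < e / 2" by simp
  from CauchyD[OF assms(1) this] CauchyD[OF assms(2) this]
  obtain M N where M: "\<And>i j. M \<le> i \<Longrightarrow> M \<le> j \<Longrightarrow> norm (x i - x j) < e / 2"
    and N: "\<And>i j. N \<le> i \<Longrightarrow> N \<le> j \<Longrightarrow> norm (y i - y j) < e / 2" by blast
  have "norm ((x i - y i) - (x j - y j)) < e" if "max M N \<le> i" "max M N \<le> j" for i j
  proof -
    have "norm ((x i - y i) - (x j - y j)) = norm ((x i - x j) - (y i - y j))"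
      by (simp add: algebra_simps)
    also have "\<dots> \<le> norm (x i - x j) + norm (y i - y j)"
      by (rule norm_triangle_ineq4)
    also have "\<dots> < e"
      using M[of i j] N[of i j] that by simp
    finally show ?thesis .
  qed
  then show "\<exists>M. \<forall>i\<ge>M. \<forall>j\<ge>M. norm ((x i - y i) - (x j - y j)) < e" by blast
qed

text \<open>
  In a sequence of vectors \<open>y\<^sub>n + k\<^sub>n a\<close> with \<open>y\<^sub>n\<close> in a closed subspace at distance \<open>e > 0\<close> from \<open>a\<close>,
  differences of the coefficients \<open>k\<^sub>n\<close> are at most \<open>1 / e\<close> times those of the sequence; so both parts
  of a Cauchy sequence converge.
\<close>

lemma complete_span_finite:
  fixes S :: "'a::real_normed_vector set"
  assumes "finite S"
  shows "complete (span S)"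
  using assms
proof (induction S rule: finite_induct)
  case empty
  show ?case by (simp add: compact_imp_complete)
next
  case (insert a S)
  show ?case
  proof (cases "a \<in> span S")
    case True
    with insert.IH show ?thesis by (simp add: span_redundant)
  next
    case False
    have "open (- span S)"
      using complete_imp_closed[OF insert.IH] by (simp add: open_Compl)
    with False obtain e where e: "0 < e" "ball a e \<subseteq> - span S"
      by (auto simp: open_contains_ball)
    have far: "\<bar>k\<bar> * e \<le> norm (y + k *\<^sub>R a)" if y: "y \<in> span S" for k y
    proof (cases "k = 0")
      case k: False
      have "(- 1 / k) *\<^sub>R y \<in> span S"
        using y by (rule span_scale)
      with e(2) have "e \<le> norm (a - (- 1 / k) *\<^sub>R y)"
        by (force simp: dist_norm)
      then have "\<bar>k\<bar> * e \<le> \<bar>k\<bar> * norm (a - (- 1 / k) *\<^sub>R y)"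
        by (rule mult_left_mono) simp
      also have "\<dots> = norm (k *\<^sub>R (a - (- 1 / k) *\<^sub>R y))" by simp
      also have "k *\<^sub>R (a - (- 1 / k) *\<^sub>R y) = y + k *\<^sub>R a"
        using k by (simp add: scaleR_right_distrib)
      finally show ?thesis .
    qed simp
    show ?thesis
    proof (rule completeI)
      fix x
      assume x: "\<forall>n. x n \<in> span (insert a S)" and Cauchy: "Cauchy x"
      then have "\<forall>n. \<exists>k. x n - k *\<^sub>R a \<in> span S"
        by (simp add: span_breakdown_eq)
      then obtain k where k: "\<And>n. x n - k n *\<^sub>R a \<in> span S"
        by metis
      have "Cauchy k"
      proof (rule CauchyI)
        fix d :: real
        assume "0 < d"
        with e(1) have "0 < d * e" by simp
        from CauchyD[OF Cauchy this] obtain M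
          where M: "\<And>i j. M \<le> i \<Longrightarrow> M \<le> j \<Longrightarrow> norm (x i - x j) < d * e" by blast
        have "norm (k i - k j) < d" if "M \<le> i" "M \<le> j" for i j
        proof -
          have "\<bar>k i - k j\<bar> * e \<le>
              norm ((x i - k i *\<^sub>R a) - (x j - k j *\<^sub>R a) + (k i - k j) *\<^sub>R a)"
            by (intro far span_diff k)
          also have "\<dots> = norm (x i - x j)"
            by (simp add: algebra_simps)
          also have "\<dots> < d * e" using M that .
          finally show ?thesis using e(1) by simp
        qed
        then show "\<exists>M. \<forall>i\<ge>M. \<forall>j\<ge>M. norm (k i - k j) < d" by blast
      qed
      then obtain l where l: "k \<longlonglongrightarrow> l"
        using Cauchy_convergent convergent_def by blast
      then have ka: "(\<lambda>n. k n *\<^sub>R a) \<longlonglongrightarrow> l *\<^sub>R a"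
        by (intro tendsto_intros)
      then have diff: "Cauchy (\<lambda>n. x n - k n *\<^sub>R a)"
        by (intro Cauchy_diff Cauchy LIMSEQ_imp_Cauchy)
      obtain y where y: "y \<in> span S" "(\<lambda>n. x n - k n *\<^sub>R a) \<longlonglongrightarrow> y"
        by (rule completeE[OF insert.IH _ diff]) (simp add: k)
      have "y + l *\<^sub>R a \<in> span (insert a S)"
        unfolding span_breakdown_eq by (rule exI[of _ l]) (simp add: y(1))
      moreover have "x \<longlonglongrightarrow> y + l *\<^sub>R a"
        using tendsto_add[OF y(2) ka] by simp
      ultimately show "\<exists>z\<in>span (insert a S). x \<longlonglongrightarrow> z" by blast
    qed
  qed
qed

text \<open>
  If \<open>f a \<noteq> 0\<close>, then for every \<open>y\<close> with \<open>f y \<noteq> 0\<close> the point \<open>a - (f a / f y) y\<close> lies in the kernel,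
  hence at least as far from \<open>a\<close> as the closed kernel does.
\<close>

lemma bounded_linear_if_closed_kernel:
  fixes f :: "'a::real_normed_vector \<Rightarrow> real"
  assumes f: "linear f" and closed: "closed {x. f x = 0}"
  shows "bounded_linear f"
proof (cases "\<exists>a. f a \<noteq> 0")
  case True
  then obtain a where a: "f a \<noteq> 0" by blast
  have "open (- {x. f x = 0})"
    using closed by (simp add: open_Compl)
  with a obtain e where e: "0 < e" "ball a e \<subseteq> - {x. f x = 0}"
    by (auto simp: open_contains_ball)
  have "\<bar>f y\<bar> \<le> norm y * (\<bar>f a\<bar> / e)" for y
  proof (cases "f y = 0")
    case False
    have "f (a - (f a / f y) *\<^sub>R y) = 0"
      using False by (simp add: linear_diff[OF f] linear_scale[OF f])
    then have "a - (f a / f y) *\<^sub>R y \<notin> ball a e"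
      using e(2) by fastforce
    then have "e \<le> \<bar>f a\<bar> / \<bar>f y\<bar> * norm y"
      by (simp add: dist_norm)
    then show ?thesis
      using e(1) False by (simp add: field_simps)
  qed (use e in simp)
  then show ?thesis
    using f by (intro bounded_linear_intro[of f "\<bar>f a\<bar> / e"]) (simp_all add: linear_add linear_scale)
next
  case False
  then have "f = (\<lambda>_. 0)" by auto
  then show ?thesis by simp
qed

lemma bounded_linear_functional_finite_span:
  fixes f :: "'a::real_normed_vector \<Rightarrow> real" and S :: "'a set"
  assumes S: "finite S" "span S = UNIV" and f: "linear f"
  shows "bounded_linear f"
proof (rule bounded_linear_if_closed_kernel[OF f])
  let ?K = "{x. f x = 0}"
  obtain K where K: "K \<subseteq> ?K" "independent K" "?K \<subseteq> span K"
    by (rule maximal_independent_subset)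
  have "finite K"
    using independent_span_bound[OF S(1) K(2)] S(2) by simp
  moreover have "span K = ?K"
    using K f by (intro antisym span_minimal linear_subspace_kernel) auto
  ultimately show "closed ?K"
    using complete_span_finite complete_imp_closed by metis
qed

section \<open>Complex normed spaces over the reals\<close>

lemma scaleC_Re_Im: "a *\<^sub>C x = Re a *\<^sub>R x + Im a *\<^sub>R (\<i> *\<^sub>C x)"
proof -
  have "a *\<^sub>C x = (complex_of_real (Re a) + complex_of_real (Im a) * \<i>) *\<^sub>C x"
    by (metis complex_eq mult.commute)
  then show ?thesis
    by (simp only: scaleC_add_left scaleC_of_real flip: scaleC_scaleC)
qed

lemma clinear_add: "clinear f \<Longrightarrow> f (x + y) = f x + f y"
  and clinear_scaleC: "clinear f \<Longrightarrow> f (a *\<^sub>C x) = a *\<^sub>C f x"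
  by (simp_all add: Vector_Spaces.linear_iff)

lemma linear_if_clinear: "clinear f \<Longrightarrow> linear f"
  by (rule linearI) (simp_all add: clinear_add clinear_scaleC flip: scaleC_of_real)

lemma bounded_linear_scaleC: "bounded_linear ((*\<^sub>C) a)"
proof (rule bounded_linear_intro[of _ "cmod a"])
  fix r :: real and x :: 'a
  have "a *\<^sub>C complex_of_real r *\<^sub>C x = complex_of_real r *\<^sub>C a *\<^sub>C x"
    by (simp add: scaleC_scaleC mult.commute)
  then show "a *\<^sub>C r *\<^sub>R x = r *\<^sub>R a *\<^sub>C x"
    by (simp add: scaleC_of_real)
qed (simp_all add: scaleC_add_right norm_scaleC mult.commute)

text \<open>A complex basis together with its multiple by \<open>\<i>\<close> spans over the reals.\<close>

lemma finite_real_span_if_finite_dimensional: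
  assumes "finite_dimensional_vector_space (scaleC :: complex \<Rightarrow> 'b \<Rightarrow> 'b) Bs"
  obtains S :: "'b::complex_normed_vector set" where "finite S" "span S = UNIV"
proof -
  interpret C: finite_dimensional_vector_space "scaleC :: complex \<Rightarrow> 'b \<Rightarrow> 'b" Bs
    by (rule assms)
  let ?S = "Bs \<union> (*\<^sub>C) \<i> ` Bs"
  have rotate: "\<i> *\<^sub>C x \<in> span ?S" if "x \<in> span ?S" for x
  proof -
    have lin: "linear ((*\<^sub>C) \<i> :: 'b \<Rightarrow> 'b)"
      using bounded_linear_scaleC bounded_linear.linear by blast
    have "\<i> *\<^sub>C \<i> *\<^sub>C y = - y" for y :: 'b
      using scaleC_of_real[of "-1" y] by (simp add: scaleC_scaleC)
    then have "(*\<^sub>C) \<i> ` ?S \<subseteq> span ?S"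
      by (auto intro!: span_neg intro: span_base)
    then have "span ((*\<^sub>C) \<i> ` ?S) \<subseteq> span ?S"
      by (simp add: span_minimal)
    with that show ?thesis
      by (auto simp: linear_span_image[OF lin])
  qed
  have "a *\<^sub>C x \<in> span ?S" if "x \<in> span ?S" for a x
    using that by (subst scaleC_Re_Im) (intro span_add span_scale rotate)
  then have "C.subspace (span ?S)"
    by (intro C.subspaceI span_zero span_add)
  then have "C.span Bs \<subseteq> span ?S"
    by (intro C.span_minimal) (auto intro: span_base)
  then have "span ?S = UNIV"
    by (auto simp: C.span_Basis)
  with C.finite_Basis show ?thesis
    by (intro that[of ?S]) auto
qed

text \<open>The only candidate for a complex linear functional with real part \<open>f\<close>.\<close>

definition complexify :: "('a::complex_normed_vector \<Rightarrow> real) \<Rightarrow> 'a \<Rightarrow> complex" where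
  "complexify f y = Complex (f y) (- f (\<i> *\<^sub>C y))"

lemma Re_complexify [simp]: "Re (complexify f y) = f y"
  by (simp add: complexify_def)

lemma clinear_complexify:
  assumes f: "linear f"
  shows "clinear (complexify f)"
proof -
  have "complexify f (a *\<^sub>C x) = a *\<^sub>C complexify f x" for a x
  proof -
    have "\<i> *\<^sub>C a *\<^sub>C x = Re a *\<^sub>R (\<i> *\<^sub>C x) + (- Im a) *\<^sub>R x"
      using scaleC_Re_Im[of "\<i> * a" x] by (simp add: scaleC_scaleC)
    then have "f (\<i> *\<^sub>C a *\<^sub>C x) = Re a * f (\<i> *\<^sub>C x) - Im a * f x"
      by (simp add: linear_add[OF f] linear_scale[OF f] linear_diff[OF f])
    moreover have "f (a *\<^sub>C x) = Re a * f x + Im a * f (\<i> *\<^sub>C x)"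
      by (simp add: scaleC_Re_Im[of a x] linear_add[OF f] linear_scale[OF f])
    ultimately show ?thesis
      by (simp add: complexify_def scaleC_complex_def complex_eq_iff)
  qed
  moreover have "complexify f (x + y) = complexify f x + complexify f y" for x y
    by (simp add: complexify_def complex_eq_iff linear_add[OF f] scaleC_add_right)
  ultimately show ?thesis
    by (simp add: Vector_Spaces.linear_iff vector_space_scaleC)
qed

lemma complexify_in_continuous_dual:
  assumes "bounded_linear f"
  shows "complexify f \<in> continuous_dual"
proof -
  have "continuous_on UNIV f"
    using assms linear_continuous_on by blast
  moreover have "continuous_on UNIV (\<lambda>y. f (\<i> *\<^sub>C y))"
    using bounded_linear_compose[OF assms bounded_linear_scaleC] linear_continuous_on by blast
  ultimately have "continuous_on UNIV (complexify f)"
    unfolding complexify_def Complex_eq by (intro continuous_intros)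
  with assms show ?thesis
    by (simp add: continuous_dual_def clinear_complexify bounded_linear.linear)
qed

lemma bounded_linear_if_continuous_clinear:
  fixes \<phi> :: "'a::complex_normed_vector \<Rightarrow> complex"
  assumes \<phi>: "clinear \<phi>" and cont: "continuous_on UNIV \<phi>"
  shows "bounded_linear \<phi>"
proof -
  have "bounded_linear (\<lambda>x. Re (\<phi> x))" "bounded_linear (\<lambda>x. Im (\<phi> x))"
    using linear_if_clinear[OF \<phi>] cont
    by (auto intro!: bounded_linear_if_closed_kernel closed_Collect_eq continuous_intros
        simp: linear_iff)
  then have "bounded_linear (\<lambda>x. Re (\<phi> x) *\<^sub>R 1 + Im (\<phi> x) *\<^sub>R \<i>)"
    by (intro bounded_linear_add bounded_linear_scaleR_const)
  also have "(\<lambda>x. Re (\<phi> x) *\<^sub>R 1 + Im (\<phi> x) *\<^sub>R \<i>) = \<phi>"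
    by (simp add: fun_eq_iff complex_eq_iff)
  finally show ?thesis .
qed

text \<open>
  Multiplying \<open>x\<close> by a suitable unit \<open>a\<close> makes \<open>\<phi> x\<close> real and nonnegative without changing the
  norms, so that a bound on the real part bounds \<open>\<phi>\<close>.
\<close>

lemma norm_clinear_le_if_Re_le:
  fixes \<phi> :: "'a::complex_normed_vector \<Rightarrow> complex"
  assumes \<phi>: "clinear \<phi>" and le: "\<And>x. Re (\<phi> x) \<le> norm x"
  shows "norm (\<phi> x) \<le> norm x"
proof (cases "\<phi> x = 0")
  case False
  define a where "a = cnj (\<phi> x) / norm (\<phi> x)"
  have "a * \<phi> x = complex_of_real (norm (\<phi> x))"
    using False complex_norm_square[of "\<phi> x"]
    by (simp add: a_def field_simps power2_eq_square)
  then have "norm (\<phi> x) = Re (\<phi> (a *\<^sub>C x))"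
    by (simp add: clinear_scaleC[OF \<phi>] scaleC_complex_def)
  also have "\<dots> \<le> norm (a *\<^sub>C x)"
    by (rule le)
  also have "\<dots> = norm x"
    using False by (simp add: norm_scaleC a_def norm_divide)
  finally show ?thesis .
qed simp

section \<open>The quotient seminorm and the duality\<close>

lemma quotient_norm_le: "T x = y \<Longrightarrow> quotient_norm T y \<le> norm x"
  unfolding quotient_norm_def by (rule cInf_lower) (auto intro: bdd_belowI[of _ 0])

lemma quotient_norm_greatest:
  assumes "surj T" and "\<And>x. T x = y \<Longrightarrow> r \<le> norm x"
  shows "r \<le> quotient_norm T y"
  unfolding quotient_norm_def
proof (rule cInf_greatest)
  obtain x where "T x = y"
    using \<open>surj T\<close> by (metis surjD)
  then show "{norm x |x. T x = y} \<noteq> {}" by blast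
qed (use assms(2) in blast)

lemma quotient_norm_nonneg: "surj T \<Longrightarrow> 0 \<le> quotient_norm T y"
  by (rule quotient_norm_greatest) simp_all

lemma sublinear_quotient_norm:
  assumes T: "linear T" "surj T"
  shows "sublinear (quotient_norm T)"
proof (rule sublinearI)
  fix x y
  have "quotient_norm T (x + y) - quotient_norm T y \<le> quotient_norm T x"
  proof (rule quotient_norm_greatest[OF T(2)])
    fix v
    assume v: "T v = x"
    have "quotient_norm T (x + y) - norm v \<le> quotient_norm T y"
    proof (rule quotient_norm_greatest[OF T(2)])
      fix w
      assume "T w = y"
      with v have "quotient_norm T (x + y) \<le> norm (v + w)"
        by (intro quotient_norm_le) (simp add: linear_add[OF T(1)])
      also have "\<dots> \<le> norm v + norm w" by (rule norm_triangle_ineq)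
      finally show "quotient_norm T (x + y) - norm v \<le> norm w" by simp
    qed
    then show "quotient_norm T (x + y) - quotient_norm T y \<le> norm v" by simp
  qed
  then show "quotient_norm T (x + y) \<le> quotient_norm T x + quotient_norm T y" by simp
next
  fix t :: real and y
  assume t: "0 < t"
  have "quotient_norm T (t *\<^sub>R y) / t \<le> quotient_norm T y"
  proof (rule quotient_norm_greatest[OF T(2)])
    fix x
    assume "T x = y"
    then have "quotient_norm T (t *\<^sub>R y) \<le> norm (t *\<^sub>R x)"
      by (intro quotient_norm_le) (simp add: linear_scale[OF T(1)])
    with t show "quotient_norm T (t *\<^sub>R y) / t \<le> norm x"
      by (simp add: field_simps)
  qed
  with t show "quotient_norm T (t *\<^sub>R y) \<le> t * quotient_norm T y"
    by (simp add: field_simps)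
next
  show "quotient_norm T 0 = 0"
    using quotient_norm_le[of T 0 0] quotient_norm_nonneg[OF T(2), of 0]
    by (simp add: linear_0[OF T(1)])
qed

text \<open>
  Every \<open>\<phi>\<close> with \<open>\<parallel>\<phi> \<circ> T\<parallel> \<le> 1\<close> has \<open>Re (\<phi> (T x)) \<le> \<parallel>x\<parallel>\<close>, hence \<open>Re \<circ> \<phi> \<le> q\<^sub>T\<close>.
\<close>

lemma weak_duality:
  assumes T: "clinear T" "continuous_on UNIV T" "surj T"
    and U: "compact U" "u \<in> U"
    and \<phi>: "\<phi> \<in> continuous_dual" "onorm (\<phi> \<circ> T) \<le> 1"
  shows "Re (\<phi> b) - support_function U (\<lambda>v. - \<phi> v) \<le> quotient_norm T (b + u)"
proof (rule quotient_norm_greatest[OF T(3)])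
  fix x
  assume x: "T x = b + u"
  have lin: "clinear \<phi>" and cont: "continuous_on UNIV \<phi>"
    using \<phi>(1) by (auto simp: continuous_dual_def)
  have "clinear (\<phi> \<circ> T)"
    using lin T(1) by (auto simp: Vector_Spaces.linear_iff)
  moreover have "continuous_on UNIV (\<phi> \<circ> T)"
    using T(2) cont by (blast intro: continuous_on_compose continuous_on_subset)
  ultimately have "bounded_linear (\<phi> \<circ> T)"
    by (rule bounded_linear_if_continuous_clinear)
  \<comment> \<open>Compactness of \<open>U\<close> makes the real supremum \<open>\<sigma>\<^sub>U (-\<phi>)\<close> an upper bound.\<close>
  have "compact ((\<lambda>v. Re (- \<phi> v)) ` U)"
    using cont by (intro compact_continuous_image U continuous_intros) (rule continuous_on_subset, auto)
  then have "bdd_above ((\<lambda>v. Re (- \<phi> v)) ` U)"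
    by (intro bounded_imp_bdd_above compact_imp_bounded)
  then have "Re (- \<phi> u) \<le> support_function U (\<lambda>v. - \<phi> v)"
    unfolding support_function_def using U(2) by (rule cSUP_upper2) simp
  then have "Re (\<phi> b) - support_function U (\<lambda>v. - \<phi> v) \<le> Re (\<phi> (b + u))"
    by (simp add: clinear_add[OF lin])
  also have "\<dots> \<le> norm ((\<phi> \<circ> T) x)"
    by (simp add: x complex_Re_le_cmod)
  also have "\<dots> \<le> onorm (\<phi> \<circ> T) * norm x"
    by (rule onorm) fact
  also have "\<dots> \<le> 1 * norm x"
    by (rule mult_right_mono) (simp_all add: \<phi>(2))
  finally show "Re (\<phi> b) - support_function U (\<lambda>v. - \<phi> v) \<le> norm x" by simp
qed

text \<open>
  Taking for \<open>m\<close> the infimum of \<open>q\<^sub>T\<close> over \<open>b + U\<close>, this gives a maximiser of the dual problem.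
\<close>

lemma dual_attainment:
  assumes fin: "finite_dimensional_vector_space (scaleC :: complex \<Rightarrow> 'b \<Rightarrow> 'b) Bs"
    and T: "clinear T" "surj T"
    and U: "convex U" "U \<noteq> {}"
    and m: "\<And>u. u \<in> U \<Longrightarrow> m \<le> quotient_norm T (b + u)"
  obtains \<phi> :: "'b::complex_normed_vector \<Rightarrow> complex"
  where "\<phi> \<in> continuous_dual" "onorm (\<phi> \<circ> T) \<le> 1"
    "m \<le> Re (\<phi> b) - support_function U (\<lambda>v. - \<phi> v)"
proof -
  obtain S :: "'b set" where S: "finite S" "span S = UNIV"
    using fin by (rule finite_real_span_if_finite_dimensional)
  have C: "convex ((+) b ` U)" "(+) b ` U \<noteq> {}"
    using U by (auto simp: convex_translation)
  have bound: "m \<le> quotient_norm T c" if "c \<in> (+) b ` U" for c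
    using that m by auto
  obtain f where f: "linear f" "\<And>y. f y \<le> quotient_norm T y" "\<And>c. c \<in> (+) b ` U \<Longrightarrow> m \<le> f c"
    using mazur_orlicz[OF S sublinear_quotient_norm[OF linear_if_clinear[OF T(1)] T(2)] C bound]
    by blast
  show ?thesis
  proof
    show "complexify f \<in> continuous_dual"
      using bounded_linear_functional_finite_span[OF S f(1)]
      by (rule complexify_in_continuous_dual)
    have "clinear (complexify f \<circ> T)"
      using clinear_complexify[OF f(1)] T(1) by (auto simp: Vector_Spaces.linear_iff)
    moreover have "Re ((complexify f \<circ> T) x) \<le> norm x" for x
      using f(2)[of "T x"] quotient_norm_le[of T x "T x"] by simp
    ultimately have "norm ((complexify f \<circ> T) x) \<le> norm x" for x
      by (rule norm_clinear_le_if_Re_le)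
    then show "onorm (complexify f \<circ> T) \<le> 1"
      by (intro onorm_bound) simp_all
    have "support_function U (\<lambda>v. - complexify f v) \<le> f b - m"
      unfolding support_function_def
    proof (rule cSUP_least[OF U(2)])
      fix u
      assume "u \<in> U"
      then show "Re (- complexify f u) \<le> f b - m"
        using f(3)[of "b + u"] by (simp add: linear_add[OF f(1)])
    qed
    then show "m \<le> Re (complexify f b) - support_function U (\<lambda>v. - complexify f v)"
      by simp
  qed
qed

theorem theorem29p5:
  fixes T :: "'x::complex_normed_vector \<Rightarrow> 'b::complex_normed_vector"
    and U :: "'b set"
    and b :: 'b
  assumes "\<exists>Bs. finite_dimensional_vector_space (scaleC :: complex \<Rightarrow> 'b \<Rightarrow> 'b) Bs"
    and "clinear T"
    and "continuous_on UNIV T"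
    and "surj T"
    and "U \<noteq> {}"
    and "compact U"
    and "convex U"
  shows "ereal (INF u\<in>U. quotient_norm T (b + u)) =
    (SUP \<phi>\<in>{\<phi> \<in> continuous_dual. onorm (\<phi> \<circ> T) \<le> 1}.
      ereal (Re (\<phi> b) - support_function U (\<lambda>v. - \<phi> v)))"
proof (rule antisym)
  obtain Bs where fin: "finite_dimensional_vector_space (scaleC :: complex \<Rightarrow> 'b \<Rightarrow> 'b) Bs"
    using assms(1) by blast
  have "bdd_below ((\<lambda>u. quotient_norm T (b + u)) ` U)"
    by (rule bdd_belowI[of _ 0]) (auto simp: quotient_norm_nonneg[OF assms(4)])
  then have lower: "(INF u\<in>U. quotient_norm T (b + u)) \<le> quotient_norm T (b + u)"
    if "u \<in> U" for u
    using that by (rule cINF_lower)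
  obtain \<phi> :: "'b \<Rightarrow> complex"
    where "\<phi> \<in> continuous_dual" "onorm (\<phi> \<circ> T) \<le> 1"
      "(INF u\<in>U. quotient_norm T (b + u)) \<le> Re (\<phi> b) - support_function U (\<lambda>v. - \<phi> v)"
    using dual_attainment[OF fin assms(2,4,7,5) lower] by blast
  then show "ereal (INF u\<in>U. quotient_norm T (b + u)) \<le>
    (SUP \<phi>\<in>{\<phi> \<in> continuous_dual. onorm (\<phi> \<circ> T) \<le> 1}.
      ereal (Re (\<phi> b) - support_function U (\<lambda>v. - \<phi> v)))"
    by (intro SUP_upper2[of \<phi>]) auto
next
  show "(SUP \<phi>\<in>{\<phi> \<in> continuous_dual. onorm (\<phi> \<circ> T) \<le> 1}.
      ereal (Re (\<phi> b) - support_function U (\<lambda>v. - \<phi> v)))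
    \<le> ereal (INF u\<in>U. quotient_norm T (b + u))"
    using weak_duality[OF assms(2-4,6)] assms(5)
    by (auto intro!: SUP_least cINF_greatest)
qed

end
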